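(* The following conditions on a prime $p$ are equivalent: (i) $D_p$ has an (affine) panmagic coset in which all permutations have the same cycle type; (ii) $D_p$ has an (affine) panmagic coset whose strict arity is odd; (iii) $D_p$ has a strictly ternary (affine) panmagic coset; (iv) $p=4k+1$ for a positive integer $k$.
   Context: $S_p$ is the group of permutations of $\{1,\dots,p\}$, identified with the group of permutations of the residues $\mathbb{Z}_p$ (with $p$ identified with the residue $0$). $\phi(i)\equiv 1-i$ is the flip and $\varkappa(i)\equiv i+1\pmod p$ is the cyclic shift; $D_p:=\langle\phi,\varkappa\rangle\le S_p$ is the dihedral group. For $a\in\mathbb{Z}_p^\times$ (the units of $\mathbb{Z}_p$), $\pi_a\in S_p$ is $\pi_a(i)\equiv ai\pmod p$. A unit $a\in\mathbb{Z}_p^\times$ is called panmagic if $a+1$ and $a-1$ are also units, i.e. $a\ne 0,\pm1$. An (affine) panmagic coset of $D_p$ is a coset $\pi_aD_p$ with $a$ a panmagic unit. For $N\ge2$, a subset $C$ of a group is closed under $N$-ary multiplication if $a_1\cdots a_N\in C$ for all $a_1,\dots,a_N\in C$. $C$ is strictly $N$-ary, and $N$ is its strict arity, if it is closed under $N$-ary multiplication but not under $N'$-ary multiplication for any $N'$ with $2\le N'<N$. Strictly ternary means strictly $3$-ary. The cycle type of a permutation is the number and lengths of the cycles in its disjoint cycle decomposition. *)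

theory Defs
  imports
    "HOL-Algebra.Sym_Groups"
    "HOL-Algebra.Generated_Groups"
    "HOL-Algebra.Coset"
    "HOL-Number_Theory.Residues"
    "HOL-Combinatorics.Orbits"
    "HOL-Library.Multiset"
begin

(* The representative in {1..p} of an integer modulo p; residue 0 is represented by p. *)
definition residue_rep :: "nat \<Rightarrow> int \<Rightarrow> nat"
  where "residue_rep p z = (if z mod int p = 0 then p else nat (z mod int p))"

(* A map on the residues modulo p, transported to {1..p}. It is the identity outside {1..p},
   as membership in the carrier of sym_group p requires. *)
definition residue_map :: "nat \<Rightarrow> (int \<Rightarrow> int) \<Rightarrow> nat \<Rightarrow> nat"
  where "residue_map p f i = (if i \<in> {1..p} then residue_rep p (f (int i)) else i)"

definition flip :: "nat \<Rightarrow> nat \<Rightarrow> nat"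
  where "flip p = residue_map p (\<lambda>i. 1 - i)"

definition cyclic_shift :: "nat \<Rightarrow> nat \<Rightarrow> nat"
  where "cyclic_shift p = residue_map p (\<lambda>i. i + 1)"

definition mult_perm :: "nat \<Rightarrow> int \<Rightarrow> nat \<Rightarrow> nat"
  where "mult_perm p a = residue_map p (\<lambda>i. a * i)"

definition dihedral :: "nat \<Rightarrow> (nat \<Rightarrow> nat) set"
  where "dihedral p = generate (sym_group p) {flip p, cyclic_shift p}"

definition panmagic_units :: "nat \<Rightarrow> int set"
  where "panmagic_units p =
    (let R = residue_ring (int p) in
      {a \<in> Units R. a \<oplus>\<^bsub>R\<^esub> \<one>\<^bsub>R\<^esub> \<in> Units R \<and> a \<ominus>\<^bsub>R\<^esub> \<one>\<^bsub>R\<^esub> \<in> Units R})"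

definition panmagic_cosets :: "nat \<Rightarrow> (nat \<Rightarrow> nat) set set"
  where "panmagic_cosets p =
    {mult_perm p a <#\<^bsub>sym_group p\<^esub> dihedral p | a. a \<in> panmagic_units p}"

definition closed_nary :: "('a, 'b) monoid_scheme \<Rightarrow> nat \<Rightarrow> 'a set \<Rightarrow> bool"
  where "closed_nary G N C \<longleftrightarrow>
    (\<forall>as. length as = N \<and> set as \<subseteq> C \<longrightarrow> foldr (\<otimes>\<^bsub>G\<^esub>) as \<one>\<^bsub>G\<^esub> \<in> C)"

definition strictly_nary :: "('a, 'b) monoid_scheme \<Rightarrow> nat \<Rightarrow> 'a set \<Rightarrow> bool"
  where "strictly_nary G N C \<longleftrightarrow>
    2 \<le> N \<and> closed_nary G N C \<and> (\<forall>N'. 2 \<le> N' \<and> N' < N \<longrightarrow> \<not> closed_nary G N' C)"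

(* The supports of the disjoint cycles of a permutation of {1..n} are its distinct orbits;
   fixed points count as cycles of length 1. *)
definition cycle_type :: "nat \<Rightarrow> (nat \<Rightarrow> nat) \<Rightarrow> nat multiset"
  where "cycle_type n \<sigma> = image_mset card (mset_set (orbit \<sigma> ` {1..n}))"

end

theory Submission
  imports Defs "HOL-Number_Theory.Pocklington" "HOL-Number_Theory.Euler_Criterion"
begin

text \<open>
  Every permutation in sight is an affine map \<open>i \<mapsto> b i + c\<close> of the residues modulo \<open>p\<close>. The dihedral
  group consists of those with linear part \<open>b = \<plusminus>1\<close> (lemma \<open>dihedral_eq\<close>), so the coset of
  \<open>\<pi>\<^sub>a\<close> consists of those with linear part \<open>\<plusminus>a\<close>. Composition multiplies linear parts, and this
  turns all four conditions into statements about the powers of \<open>a\<close> and \<open>-a\<close>.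

  Arity: a product of \<open>m + 1\<close> elements of the coset has linear part \<open>\<plusminus>a\<^bsup>m+1\<^esup>\<close>, so the coset is
  closed under such products iff \<open>a\<^sup>m = \<plusminus>1\<close> (lemma \<open>closed_nary_affine_coset_iff\<close>).
  If \<open>m = 2 n\<close> is the least positive exponent with this property, then \<open>a\<^sup>m = 1\<close> is impossible, since
  it would give \<open>a\<^sup>n = \<plusminus>1\<close>; hence \<open>a\<^sup>n\<close> is a square root of \<open>-1\<close>.

  Cycle type: if \<open>b \<noteq> 1\<close>, then \<open>i \<mapsto> b i + c\<close> has one fixed point, and in the coordinate centred there
  it is multiplication by \<open>b\<close>. All other cycles therefore have the order of \<open>b\<close> as their length
  (lemma \<open>cycle_type_affine_perm\<close>). For a panmagic \<open>a\<close> neither \<open>a\<close> nor \<open>-a\<close> is 1, so the cycle types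
  in the coset agree iff \<open>a\<close> and \<open>-a\<close> have the same order. This forces the order to be divisible
  by 4, which again yields a square root of \<open>-1\<close>
  (lemma \<open>same_order_minus_imp_sqrt_minus_one\<close>).

  Conversely, if \<open>y\<^sup>2 = -1\<close> and \<open>p > 2\<close>, then \<open>y\<close> is panmagic, \<open>y\<close> and \<open>-y\<close> both have order 4, and
  2 is the least positive exponent with \<open>y\<^sup>m = \<plusminus>1\<close>. All conditions are thus equivalent to \<open>-1\<close> being
  a square modulo an odd prime \<open>p\<close>, which by Euler's criterion means \<open>p = 4 k + 1\<close>.
\<close>

section \<open>Affine permutations of the residues\<close>

definition affine_perm :: "nat \<Rightarrow> int \<Rightarrow> int \<Rightarrow> nat \<Rightarrow> nat"
  where "affine_perm p b c = residue_map p (\<lambda>i. b * i + c)"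

lemma residue_rep_range: "0 < p \<Longrightarrow> residue_rep p z \<in> {1..p}"
  using pos_mod_bound[of "int p" z] pos_mod_sign[of "int p" z]
  by (auto simp: residue_rep_def simp del: pos_mod_bound pos_mod_sign)

lemma cong_residue_rep: "0 < p \<Longrightarrow> [int (residue_rep p z) = z] (mod int p)"
  by (auto simp: residue_rep_def cong_def)

text \<open>
  Together with \<open>affine_perm_range\<close> and \<open>affine_perm_cong\<close>, the next lemma reduces every identity
  between affine permutations to a congruence.
\<close>

lemma eq_if_cong_range:
  assumes "i \<in> {1..p}" "j \<in> {1..p}" "[int i = int j] (mod int p)"
  shows "i = j"
proof -
  have "[int i - 1 = int j - 1] (mod int p)"
    using assms(3) by (intro cong_diff) auto
  then show ?thesis
    using assms(1,2) cong_less_imp_eq_int[of "int i - 1" "int p" "int j - 1"] by simp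
qed

lemma affine_perm_range: "i \<in> {1..p} \<Longrightarrow> affine_perm p b c i \<in> {1..p}"
  using residue_rep_range[of p] by (auto simp: affine_perm_def residue_map_def)

lemma affine_perm_outside: "i \<notin> {1..p} \<Longrightarrow> affine_perm p b c i = i"
  by (auto simp: affine_perm_def residue_map_def)

lemma affine_perm_cong:
  "i \<in> {1..p} \<Longrightarrow> [int (affine_perm p b c i) = b * int i + c] (mod int p)"
  using cong_residue_rep[of p] by (auto simp: affine_perm_def residue_map_def)

lemma affine_perm_eqI:
  assumes "\<And>i. i \<in> {1..p} \<Longrightarrow> \<sigma> i \<in> {1..p}" "\<And>i. i \<notin> {1..p} \<Longrightarrow> \<sigma> i = i"
    and "\<And>i. i \<in> {1..p} \<Longrightarrow> [int (\<sigma> i) = b * int i + c] (mod int p)"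
  shows "\<sigma> = affine_perm p b c"
proof
  fix i
  show "\<sigma> i = affine_perm p b c i"
  proof (cases "i \<in> {1..p}")
    case True
    then show ?thesis
      using assms affine_perm_range[OF True] affine_perm_cong[OF True]
      by (meson eq_if_cong_range cong_sym cong_trans)
  qed (simp add: assms(2) affine_perm_outside)
qed

lemma affine_perm_eq_iff:
  assumes "1 < p"
  shows "affine_perm p b c = affine_perm p b' c' \<longleftrightarrow>
    [b = b'] (mod int p) \<and> [c = c'] (mod int p)"
proof
  assume eq: "affine_perm p b c = affine_perm p b' c'"
  have *: "[b * int i + c = b' * int i + c'] (mod int p)" if "i \<in> {1..p}" for i
    using affine_perm_cong[OF that, of b c] affine_perm_cong[OF that, of b' c'] eq
    by (metis cong_sym cong_trans)
  \<comment> \<open>The representative \<open>p\<close> of the residue 0 isolates the constant term.\<close>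
  have c: "[c = c'] (mod int p)"
    using *[of p] assms by (simp add: cong_def)
  moreover have "[b + c = b' + c'] (mod int p)"
    using *[of 1] assms by simp
  then have "[b + c - c = b' + c' - c'] (mod int p)"
    using c by (rule cong_diff)
  ultimately show "[b = b'] (mod int p) \<and> [c = c'] (mod int p)" by simp
next
  assume "[b = b'] (mod int p) \<and> [c = c'] (mod int p)"
  then show "affine_perm p b c = affine_perm p b' c'"
    by (intro affine_perm_eqI cong_trans[OF affine_perm_cong] cong_add cong_mult)
      (simp_all only: affine_perm_range affine_perm_outside cong_refl not_False_eq_True)
qed

lemma affine_perm_comp:
  "affine_perm p b c \<circ> affine_perm p b' c' = affine_perm p (b * b') (b * c' + c)"
proof (intro affine_perm_eqI)
  fix i assume i: "i \<in> {1..p}"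
  have "[b * int (affine_perm p b' c' i) + c = b * (b' * int i + c') + c] (mod int p)"
    using affine_perm_cong[OF i] by (intro cong_add cong_mult) auto
  then show "[int ((affine_perm p b c \<circ> affine_perm p b' c') i)
      = b * b' * int i + (b * c' + c)] (mod int p)"
    using affine_perm_cong[OF affine_perm_range[OF i]]
    by (metis (no_types, lifting) ab_semigroup_add_class.add_ac(1) ab_semigroup_mult_class.mult_ac(1)
        comp_apply cong_trans distrib_left)
qed (auto simp: affine_perm_outside affine_perm_range simp del: atLeastAtMost_iff One_nat_def)

lemma affine_perm_id: "affine_perm p 1 0 = id"
  by (rule sym, rule affine_perm_eqI) auto

lemma coprime_if_not_prime_dvd:
  assumes "prime p" "\<not> int p dvd b"
  shows "coprime b (int p)"
  using prime_imp_coprime[of "int p" b] assms by (simp add: coprime_commute)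

lemma affine_perm_permutes:
  assumes "prime p" "\<not> int p dvd b"
  shows "affine_perm p b c permutes {1..p}"
proof (rule bij_imp_permutes)
  have "inj_on (affine_perm p b c) {1..p}"
  proof (rule inj_onI)
    fix i j assume ij: "i \<in> {1..p}" "j \<in> {1..p}" "affine_perm p b c i = affine_perm p b c j"
    then have "[b * int i + c = b * int j + c] (mod int p)"
      using affine_perm_cong[of i p b c] affine_perm_cong[of j p b c]
      by (metis cong_sym cong_trans)
    then have "[b * int i = b * int j] (mod int p)"
      by (simp add: cong_add_rcancel)
    then have "[int i = int j] (mod int p)"
      using coprime_if_not_prime_dvd[OF assms] by (simp add: cong_mult_lcancel)
    then show "i = j" using ij eq_if_cong_range by blast
  qed
  moreover have "affine_perm p b c ` {1..p} \<subseteq> {1..p}"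
    using affine_perm_range by blast
  ultimately show "bij_betw (affine_perm p b c) {1..p} {1..p}"
    by (simp add: bij_betw_def endo_inj_surj)
qed (rule affine_perm_outside)

section \<open>The dihedral group and its panmagic cosets\<close>

text \<open>
  The inductive definition of the generated subgroup adjoins inverses of generators; here they are
  seen to be affine again.
\<close>

lemma inv_sym_group_affine_perm:
  assumes "prime p" "[b * b' = 1] (mod int p)"
  shows "inv\<^bsub>sym_group p\<^esub> (affine_perm p b c) = affine_perm p b' (- b' * c)"
proof -
  have p1: "1 < p" using assms(1) by (rule prime_gt_1_nat)
  have nd: "\<not> int p dvd b" "\<not> int p dvd b'"
  proof -
    have "int p dvd b * b' - 1" using assms(2) by (simp add: cong_iff_dvd_diff)
    moreover have "\<not> int p dvd 1" using p1 by (auto dest: zdvd_imp_le)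
    ultimately have "\<not> int p dvd b * b'" using dvd_diff_right_iff by blast
    then show "\<not> int p dvd b" "\<not> int p dvd b'" by auto
  qed
  show ?thesis
  proof (rule group.inv_equality[OF sym_group_is_group])
    show "affine_perm p b' (- b' * c) \<otimes>\<^bsub>sym_group p\<^esub> affine_perm p b c = \<one>\<^bsub>sym_group p\<^esub>"
      using assms(2)
      by (simp add: sym_group_mult sym_group_one affine_perm_comp affine_perm_id[of p, symmetric]
          affine_perm_eq_iff[OF p1] mult.commute)
  qed (simp_all only: sym_group_carrier affine_perm_permutes[OF assms(1)] nd not_False_eq_True)
qed

text \<open>
  The maps with linear part \<open>\<plusminus>1\<close> contain both generators and are closed under composition.
  Conversely the powers of the shift are all translations, and a translation after the flip gives
  every map with linear part \<open>-1\<close>.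
\<close>

lemma dihedral_eq:
  assumes "prime p"
  shows "dihedral p = {affine_perm p e c | e c. e \<in> {1, -1}}" (is "_ = ?D")
proof
  have flip: "flip p = affine_perm p (-1) 1"
    by (simp add: flip_def affine_perm_def)
  have shift: "cyclic_shift p = affine_perm p 1 1"
    by (simp add: cyclic_shift_def affine_perm_def)
  show "dihedral p \<subseteq> ?D"
  proof
    fix \<sigma> assume "\<sigma> \<in> dihedral p"
    then have "\<sigma> \<in> generate (sym_group p) {flip p, cyclic_shift p}"
      by (simp add: dihedral_def)
    then show "\<sigma> \<in> ?D"
    proof (induction rule: generate.induct)
      case one
      show ?case unfolding sym_group_one affine_perm_id[of p, symmetric] by blast
    next
      case (incl h)
      then show ?case by (auto simp: flip shift)
    next
      case (inv h)
      then show ?case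
        using inv_sym_group_affine_perm[OF assms, of "-1" "-1" 1]
          inv_sym_group_affine_perm[OF assms, of 1 1 1]
        by (auto simp: flip shift)
    next
      case (eng g h)
      then obtain e c e' c' where
        "g = affine_perm p e c" "h = affine_perm p e' c'" "e \<in> {1,-1}" "e' \<in> {1,-1}"
        by blast
      then show ?case
        by (simp add: sym_group_mult affine_perm_comp) (metis mult_1 mult_minus1 minus_minus)
    qed
  qed
  have comp: "\<sigma> \<circ> \<tau> \<in> dihedral p" if "\<sigma> \<in> dihedral p" "\<tau> \<in> dihedral p" for \<sigma> \<tau>
    using generate.eng[of \<sigma> "sym_group p" _ \<tau>] that by (simp only: dihedral_def sym_group_mult)
  have gens: "affine_perm p 1 1 \<in> dihedral p" "affine_perm p (-1) 1 \<in> dihedral p"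
    unfolding dihedral_def flip shift by (rule generate.incl, simp)+
  have pow: "affine_perm p 1 (int n) \<in> dihedral p" for n
  proof (induction n)
    case 0
    show ?case
      using generate.one[of "sym_group p"]
      by (simp only: dihedral_def affine_perm_id sym_group_one of_nat_0)
  next
    case (Suc n)
    from comp[OF Suc gens(1)] show ?case by (simp add: affine_perm_comp)
  qed
  \<comment> \<open>The shift has order \<open>p\<close>, so its nonnegative powers already give all translations.\<close>
  have rot: "affine_perm p 1 c \<in> dihedral p" for c
  proof -
    have "affine_perm p 1 c = affine_perm p 1 (int (nat (c mod int p)))"
      using prime_gt_1_nat[OF assms] by (simp add: affine_perm_eq_iff)
    then show ?thesis using pow by metis
  qed
  show "?D \<subseteq> dihedral p"
  proof
    fix \<sigma> assume "\<sigma> \<in> ?D"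
    then obtain e c where \<sigma>: "\<sigma> = affine_perm p e c" and e: "e \<in> {1, -1}" by blast
    \<comment> \<open>The flip \<open>1 - i\<close> contributes the constant term 1.\<close>
    have "affine_perm p 1 (c - 1) \<circ> affine_perm p (-1) 1 \<in> dihedral p"
      using comp[OF rot gens(2)] .
    then show "\<sigma> \<in> dihedral p"
      using rot e by (auto simp: \<sigma> affine_perm_comp)
  qed
qed

definition affine_coset :: "nat \<Rightarrow> int \<Rightarrow> (nat \<Rightarrow> nat) set"
  where "affine_coset p a = {affine_perm p (e * a) c | e c. e \<in> {1, -1}}"

text \<open>
  Composing with \<open>\<pi>\<^sub>a\<close> multiplies both the linear part \<open>\<plusminus>1\<close> and the constant term by \<open>a\<close>. As \<open>a\<close> is
  invertible, the constant term still runs through all residues.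
\<close>

lemma l_coset_dihedral_eq:
  assumes "prime p" "\<not> int p dvd a"
  shows "mult_perm p a <#\<^bsub>sym_group p\<^esub> dihedral p = affine_coset p a"
proof -
  have pm: "mult_perm p a = affine_perm p a 0"
    by (simp add: mult_perm_def affine_perm_def)
  have p1: "1 < p" using assms(1) by (rule prime_gt_1_nat)
  have "coprime a (int p)"
    using assms by (intro coprime_if_not_prime_dvd)
  then obtain a' where a': "[a * a' = 1] (mod int p)"
    by (metis cong_solve_coprime_int)
  show ?thesis
  proof
    show "mult_perm p a <#\<^bsub>sym_group p\<^esub> dihedral p \<subseteq> affine_coset p a"
      by (auto simp: l_coset_def dihedral_eq[OF assms(1)] pm sym_group_mult affine_perm_comp
          affine_coset_def)
        (metis mult_1 mult_minus1 mult.commute)+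
    show "affine_coset p a \<subseteq> mult_perm p a <#\<^bsub>sym_group p\<^esub> dihedral p"
    proof
      fix \<sigma> assume "\<sigma> \<in> affine_coset p a"
      then obtain e c where \<sigma>: "\<sigma> = affine_perm p (e * a) c" and e: "e \<in> {1, -1}"
        by (auto simp: affine_coset_def)
      have "[a * a' * c = 1 * c] (mod int p)"
        using a' by (rule cong_mult) simp
      then have "\<sigma> = mult_perm p a \<circ> affine_perm p e (a' * c)"
        by (simp add: \<sigma> pm affine_perm_comp affine_perm_eq_iff[OF p1] mult.commute[of e]
            mult.assoc cong_sym)
      moreover have "affine_perm p e (a' * c) \<in> dihedral p"
        using e by (auto simp: dihedral_eq[OF assms(1)])
      ultimately show "\<sigma> \<in> mult_perm p a <#\<^bsub>sym_group p\<^esub> dihedral p"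
        by (auto simp: l_coset_def sym_group_mult)
    qed
  qed
qed

lemma panmagic_units_iff:
  assumes "prime p"
  shows "a \<in> panmagic_units p \<longleftrightarrow>
    0 \<le> a \<and> a < int p \<and> \<not> int p dvd a \<and> \<not> int p dvd a + 1 \<and> \<not> int p dvd a - 1"
proof -
  interpret residues_prime p "residue_ring (int p)"
    using assms by unfold_locales auto
  have U: "x mod int p \<in> Units (residue_ring (int p)) \<longleftrightarrow> \<not> int p dvd x" for x
    using pos_mod_bound[of "int p" x] pos_mod_sign[of "int p" x] prime_gt_0_nat[OF assms]
    by (auto simp: res_prime_units_eq dvd_eq_mod_eq_0 simp del: pos_mod_bound pos_mod_sign)
  have minus: "a \<ominus>\<^bsub>residue_ring (int p)\<^esub> \<one>\<^bsub>residue_ring (int p)\<^esub> = (a - 1) mod int p"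
    unfolding a_minus_def by (simp add: res_neg_eq res_add_eq res_one_eq mod_simps)
  have "a \<in> Units (residue_ring (int p)) \<longleftrightarrow> 0 \<le> a \<and> a < int p \<and> \<not> int p dvd a"
    by (auto simp: res_prime_units_eq zdvd_not_zless)
      (metis dvd_0_right int_one_le_iff_zero_less le_less)
  then show ?thesis
    by (auto simp: panmagic_units_def Let_def minus[unfolded res_one_eq] res_add_eq res_one_eq U)
qed

text \<open>
  The representative \<open>a\<close> is an arbitrary integer here, not one in \<open>{0..<p}\<close>, so that a square root
  of \<open>-1\<close> can be inserted without reducing it first.
\<close>

lemma panmagic_cosets_iff:
  assumes "prime p"
  shows "C \<in> panmagic_cosets p \<longleftrightarrow>
    (\<exists>a. \<not> int p dvd a \<and> \<not> int p dvd a + 1 \<and> \<not> int p dvd a - 1 \<and> C = affine_coset p a)"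
proof
  assume "C \<in> panmagic_cosets p"
  then show "\<exists>a. \<not> int p dvd a \<and> \<not> int p dvd a + 1 \<and> \<not> int p dvd a - 1 \<and> C = affine_coset p a"
    using assms by (auto simp: panmagic_cosets_def panmagic_units_iff l_coset_dihedral_eq)
next
  assume "\<exists>a. \<not> int p dvd a \<and> \<not> int p dvd a + 1 \<and> \<not> int p dvd a - 1 \<and> C = affine_coset p a"
  then obtain a where a: "\<not> int p dvd a" "\<not> int p dvd a + 1" "\<not> int p dvd a - 1"
    and C: "C = affine_coset p a" by blast
  have p1: "1 < p" using assms by (rule prime_gt_1_nat)
  define r where "r = a mod int p"
  have dvd: "int p dvd r + k \<longleftrightarrow> int p dvd a + k" for k
    by (simp add: r_def dvd_eq_mod_eq_0 mod_simps)
  have r: "r \<in> panmagic_units p"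
    using a p1 dvd[of 0] dvd[of 1] dvd[of "-1"] by (simp add: panmagic_units_iff[OF assms] r_def)
  have "affine_perm p (e * a) c = affine_perm p (e * r) c" for e c
    by (simp add: affine_perm_eq_iff[OF p1] r_def cong_def mod_simps)
  then have "C = affine_coset p r"
    by (simp add: C affine_coset_def)
  then show "C \<in> panmagic_cosets p"
    using r l_coset_dihedral_eq[OF assms] panmagic_units_iff[OF assms]
    by (auto simp: panmagic_cosets_def)
qed

section \<open>Arity\<close>

lemma affine_perm_in_affine_coset_iff:
  assumes "1 < p"
  shows "affine_perm p b c \<in> affine_coset p a \<longleftrightarrow>
    [b = a] (mod int p) \<or> [b = - a] (mod int p)"
  using affine_perm_eq_iff[OF assms]
  by (auto simp: affine_coset_def) (metis cong_refl mult_1 mult_minus1)+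

lemma foldr_affine_coset:
  assumes "set \<sigma>s \<subseteq> affine_coset p a"
  shows "\<exists>e\<in>{1,-1}. \<exists>c. foldr (\<circ>) \<sigma>s id = affine_perm p (e * a ^ length \<sigma>s) c"
  using assms
proof (induction \<sigma>s)
  case Nil
  show ?case using affine_perm_id[of p] by (metis foldr_Nil id_apply insertI1 list.size(3) mult_1 power_0)
next
  case (Cons \<sigma> \<sigma>s)
  then obtain e c e' c' where "e \<in> {1,-1}" "foldr (\<circ>) \<sigma>s id = affine_perm p (e * a ^ length \<sigma>s) c"
    "e' \<in> {1,-1}" "\<sigma> = affine_perm p (e' * a) c'"
    unfolding affine_coset_def by (simp only: list.set insert_subset mem_Collect_eq) blast
  then have "foldr (\<circ>) (\<sigma> # \<sigma>s) id
      = affine_perm p ((e' * e) * a ^ length (\<sigma> # \<sigma>s)) (e' * a * c + c')" "e' * e \<in> {1,-1}"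
    by (auto simp only: foldr_Cons comp_apply affine_perm_comp list.size power_Suc mult_ac
        add.commute add_0_right plus_1_eq_Suc)
      (auto simp: mult_ac)
  then show ?case by blast
qed

lemma foldr_replicate_affine_perm:
  "foldr (\<circ>) (replicate n (affine_perm p a 0)) id = affine_perm p (a ^ n) 0"
proof (induction n)
  case 0
  show ?case by (simp only: replicate_0 foldr.simps(1) id_apply power_0 affine_perm_id)
next
  case (Suc n)
  have "foldr (\<circ>) (replicate (Suc n) (affine_perm p a 0)) id
      = affine_perm p a 0 \<circ> foldr (\<circ>) (replicate n (affine_perm p a 0)) id"
    by (simp only: replicate_Suc foldr.simps(2) comp_apply[of "(\<circ>) _"])
  then show ?case
    by (simp only: Suc.IH affine_perm_comp power_Suc mult_zero_right add_0_right)
qed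

text \<open>
  A product of \<open>m + 1\<close> elements has linear part \<open>\<plusminus>a\<^bsup>m+1\<^esup>\<close>, and it lies in the coset iff this is
  \<open>\<plusminus>a\<close>; cancelling \<open>a\<close> leaves \<open>a\<^sup>m = \<plusminus>1\<close>. For necessity it suffices to look at the power of
  \<open>i \<mapsto> a i\<close>.
\<close>

lemma closed_nary_affine_coset_iff:
  assumes "prime p" "\<not> int p dvd a"
  shows "closed_nary (sym_group p) (Suc m) (affine_coset p a) \<longleftrightarrow>
    [a ^ m = 1] (mod int p) \<or> [a ^ m = - 1] (mod int p)"
proof -
  have p1: "1 < p" using assms(1) by (rule prime_gt_1_nat)
  have cop: "coprime a (int p)"
    using assms by (intro coprime_if_not_prime_dvd)
  have cancel: "[a ^ Suc m = a * x] (mod int p) \<longleftrightarrow> [a ^ m = x] (mod int p)" for x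
    using cop by (simp add: cong_mult_lcancel)
  have "closed_nary (sym_group p) (Suc m) (affine_coset p a) \<longleftrightarrow>
    [a ^ Suc m = a] (mod int p) \<or> [a ^ Suc m = - a] (mod int p)"
    (is "_ \<longleftrightarrow> ?R")
  proof
    assume cl: "closed_nary (sym_group p) (Suc m) (affine_coset p a)"
    have "affine_perm p a 0 \<in> affine_coset p a"
      by (simp add: affine_perm_in_affine_coset_iff[OF p1])
    then have "affine_perm p (a ^ Suc m) 0 \<in> affine_coset p a"
      using cl[unfolded closed_nary_def, rule_format, of "replicate (Suc m) (affine_perm p a 0)"]
      by (simp only: sym_group_mult sym_group_one foldr_replicate_affine_perm)
        (simp add: set_replicate_conv_if)
    then show ?R by (simp add: affine_perm_in_affine_coset_iff[OF p1])
  next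
    assume R: ?R
    show "closed_nary (sym_group p) (Suc m) (affine_coset p a)"
      unfolding closed_nary_def sym_group_mult sym_group_one
    proof (intro allI impI)
      fix \<sigma>s :: "(nat \<Rightarrow> nat) list"
      assume \<sigma>s: "length \<sigma>s = Suc m \<and> set \<sigma>s \<subseteq> affine_coset p a"
      then obtain e c where e: "e \<in> {1,-1}"
        and eq: "foldr (\<circ>) \<sigma>s id = affine_perm p (e * a ^ Suc m) c"
        using foldr_affine_coset[of \<sigma>s p a] by metis
      have "[e * a ^ Suc m = a] (mod int p) \<or> [e * a ^ Suc m = - a] (mod int p)"
        using R e cong_minus_minus_iff[of "a ^ Suc m" "a" "int p"]
          cong_minus_minus_iff[of "a ^ Suc m" "- a" "int p"]
        by (auto simp del: power_Suc)
      then show "foldr (\<circ>) \<sigma>s id \<in> affine_coset p a"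
        by (simp only: eq affine_perm_in_affine_coset_iff[OF p1])
    qed
  qed
  then show ?thesis using cancel[of 1] cancel[of "-1"] by simp
qed

section \<open>Cycle type\<close>

lemma card_orbit_eq_period:
  assumes "0 < m" and period: "\<And>k. (f ^^ k) x = x \<longleftrightarrow> m dvd k"
  shows "card (orbit f x) = m"
proof -
  have fm: "(f ^^ m) x = x" by (simp add: period)
  have "orbit f x = (\<lambda>k. (f ^^ k) x) ` {..<m}"
  proof
    show "orbit f x \<subseteq> (\<lambda>k. (f ^^ k) x) ` {..<m}"
      using funpow_mod_eq[OF fm] assms(1)
      by (auto simp: orbit_altdef image_iff) (metis lessThan_iff mod_less_divisor)
    show "(\<lambda>k. (f ^^ k) x) ` {..<m} \<subseteq> orbit f x"
    proof
      fix y assume "y \<in> (\<lambda>k. (f ^^ k) x) ` {..<m}"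
      then obtain k where "y = (f ^^ k) x" by auto
      then have "y = (f ^^ (k + m)) x" by (simp add: funpow_add fm)
      then show "y \<in> orbit f x" using assms(1) by (auto simp: orbit_altdef)
    qed
  qed
  moreover have "inj_on (\<lambda>k. (f ^^ k) x) {..<m}"
  proof (rule linorder_inj_onI)
    fix i j assume ij: "i < j" "i \<in> {..<m}" "j \<in> {..<m}"
    show "(f ^^ i) x \<noteq> (f ^^ j) x"
    proof
      \<comment> \<open>Applying \<open>f\<close> another \<open>m - j\<close> times returns the right side to \<open>x\<close>, so the
        left side is back at \<open>x\<close> after fewer than \<open>m\<close> steps.\<close>
      assume "(f ^^ i) x = (f ^^ j) x"
      then have "(f ^^ (m - j + i)) x = (f ^^ (m - j + j)) x" by (simp only: funpow_add comp_apply)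
      then have "m dvd m - j + i" using ij period by (simp add: fm)
      then show False using ij by (auto dest: dvd_imp_le)
    qed
  qed auto
  ultimately show ?thesis by (simp add: card_image)
qed

text \<open>
  The orders of \<open>a\<close> and \<open>-a\<close> are going to be compared, so the multiplicative order is characterised
  for integers, by reduction to the natural representative.
\<close>

lemma ex_multiplicative_order:
  assumes "prime p" "\<not> int p dvd b"
  obtains m where "0 < m" "m dvd p - 1" "\<And>k. [b ^ k = 1] (mod int p) \<longleftrightarrow> m dvd k"
proof -
  define n where "n = nat (b mod int p)"
  have p0: "0 < p" using assms(1) by (rule prime_gt_0_nat)
  have n: "int n = b mod int p" using p0 by (simp add: n_def)
  have "[b ^ k = 1] (mod int p) \<longleftrightarrow> [n ^ k = 1] (mod p)" for k
    unfolding cong_int_iff[symmetric] by (simp add: n cong_def mod_simps)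
  moreover have "\<not> p dvd n"
    using assms(2) by (simp flip: int_dvd_int_iff add: n dvd_mod_iff)
  then have "0 < ord p n" "ord p n dvd p - 1"
    using assms(1) fermat_theorem[of p n] ord_divides[of n "p - 1" p]
    by (auto simp: prime_imp_coprime)
  ultimately show ?thesis using that ord_divides by blast
qed

text \<open>
  With \<open>x\<^sub>0\<close> the solution of \<open>(b - 1) x\<^sub>0 + c = 0\<close>, the \<open>k\<close>-th iterate sends \<open>i\<close> to
  \<open>x\<^sub>0 + b\<^sup>k (i - x\<^sub>0)\<close>. A point \<open>i \<noteq> x\<^sub>0\<close> therefore returns exactly when \<open>b\<^sup>k = 1\<close>, and its orbit has
  \<open>m\<close> elements. The orbits partition \<open>{1..p}\<close>, which determines how many there are.
\<close>

lemma cycle_type_affine_perm: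
  assumes "prime p" "\<not> int p dvd b" "\<not> int p dvd b - 1"
    and "0 < m" and order: "\<And>k. [b ^ k = 1] (mod int p) \<longleftrightarrow> m dvd k"
  shows "cycle_type p (affine_perm p b c) = add_mset 1 (replicate_mset ((p - 1) div m) m)"
proof -
  let ?\<sigma> = "affine_perm p b c"
  have p1: "1 < p" using assms(1) by (rule prime_gt_1_nat)
  have m1: "m \<noteq> 1" using order[of 1] assms(3) by (auto simp: cong_iff_dvd_diff)
  have cop1: "coprime (b - 1) (int p)"
    using assms by (intro coprime_if_not_prime_dvd)
  then obtain d where "[(b - 1) * d = 1] (mod int p)"
    by (metis cong_solve_coprime_int)
  then have d: "[(b - 1) * d * c = 1 * c] (mod int p)" by (rule cong_mult) simp
  define x0 where "x0 = residue_rep p (- d * c)"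
  have x0: "x0 \<in> {1..p}" using p1 by (simp only: x0_def residue_rep_range)
  have "[(b - 1) * int x0 + c = (b - 1) * (- d * c) + c] (mod int p)"
    unfolding x0_def using cong_residue_rep p1 by (intro cong_add cong_mult) auto
  also have "[(b - 1) * (- d * c) + c = 0] (mod int p)"
    using d by (simp add: cong_iff_dvd_diff algebra_simps dvd_diff_commute)
  finally have fixpoint: "[(b - 1) * int x0 + c = 0] (mod int p)" .
  have iter: "(?\<sigma> ^^ k) i \<in> {1..p} \<and>
      [int ((?\<sigma> ^^ k) i) - int x0 = b ^ k * (int i - int x0)] (mod int p)"
    if i: "i \<in> {1..p}" for i k
  proof (induction k)
    case 0
    show ?case using i by simp
  next
    case (Suc k)
    let ?j = "(?\<sigma> ^^ k) i"
    have j: "?j \<in> {1..p}" using Suc.IH by blast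
    have "[int (?\<sigma> ?j) - int x0 = (b * int ?j + c) - int x0] (mod int p)"
      using affine_perm_cong[OF j] by (intro cong_diff) auto
    also have "(b * int ?j + c) - int x0 = b * (int ?j - int x0) + ((b - 1) * int x0 + c)"
      by (simp add: algebra_simps)
    also have "[\<dots> = b * (b ^ k * (int i - int x0)) + 0] (mod int p)"
      using Suc.IH fixpoint by (intro cong_add cong_mult) auto
    finally have "[int ((?\<sigma> ^^ Suc k) i) - int x0 = b ^ Suc k * (int i - int x0)] (mod int p)"
      by (simp add: mult.assoc)
    moreover have "(?\<sigma> ^^ Suc k) i \<in> {1..p}"
      using affine_perm_range[OF j] by simp
    ultimately show ?case by blast
  qed
  have returns: "(?\<sigma> ^^ k) i = i \<longleftrightarrow> [b ^ k * (int i - int x0) = int i - int x0] (mod int p)"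
    if "i \<in> {1..p}" for i k
  proof
    assume "(?\<sigma> ^^ k) i = i"
    then show "[b ^ k * (int i - int x0) = int i - int x0] (mod int p)"
      using iter[OF that, of k] by (simp add: cong_sym_eq)
  next
    assume "[b ^ k * (int i - int x0) = int i - int x0] (mod int p)"
    then have "[int ((?\<sigma> ^^ k) i) - int x0 = int i - int x0] (mod int p)"
      using iter[OF that, of k] cong_trans by blast
    then have "[int ((?\<sigma> ^^ k) i) = int i] (mod int p)"
      by (simp add: cong_iff_dvd_diff)
    then show "(?\<sigma> ^^ k) i = i" using iter[OF that, of k] that eq_if_cong_range by blast
  qed
  have orbit0: "orbit ?\<sigma> x0 = {x0}"
    using returns[OF x0, of 1] by (simp add: orbit_eq_singleton_iff)
  have card_orbit: "card (orbit ?\<sigma> i) = m" if i: "i \<in> {1..p}" "i \<noteq> x0" for i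
  proof (rule card_orbit_eq_period[OF assms(4)])
    fix k
    have "\<not> int p dvd int i - int x0"
      using eq_if_cong_range[OF i(1) x0] i(2) by (auto simp: cong_iff_dvd_diff)
    then have "coprime (int i - int x0) (int p)"
      using assms(1) by (intro coprime_if_not_prime_dvd)
    then have "[b ^ k * (int i - int x0) = 1 * (int i - int x0)] (mod int p)
        \<longleftrightarrow> [b ^ k = 1] (mod int p)"
      by (rule cong_mult_rcancel)
    then show "(?\<sigma> ^^ k) i = i \<longleftrightarrow> m dvd k"
      by (simp add: returns[OF i(1)] order)
  qed
  define F where "F = orbit ?\<sigma> ` ({1..p} - {x0})"
  have F: "orbit ?\<sigma> ` {1..p} = insert {x0} F"
    using x0 orbit0 by (auto simp: F_def)
  have cardF: "card X = m" if "X \<in> F" for X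
    using that card_orbit unfolding F_def by blast
  have finF: "finite F" by (simp add: F_def)
  \<comment> \<open>The fixed point must not be counted among the cycles of length \<open>m\<close>; they differ since \<open>m \<noteq> 1\<close>.\<close>
  have x0F: "{x0} \<notin> F" using cardF[of "{x0}"] m1 by auto
  have perm: "?\<sigma> permutes {1..p}" using assms by (intro affine_perm_permutes)
  then have permutation: "permutation ?\<sigma>"
    using permutation_permutes by blast
  have "pairwise disjnt (orbit ?\<sigma> ` {1..p})"
    unfolding pairwise_def disjnt_def
    using orbit_cyclic_eq3[OF cyclic_on_orbit'[OF permutation]] by blast
  moreover have "\<Union> (orbit ?\<sigma> ` {1..p}) = {1..p}"
    using permutes_orbit_subset[OF perm] permutation_self_in_orbit[OF permutation] by blast
  moreover have "finite X" if "X \<in> orbit ?\<sigma> ` {1..p}" for X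
    using that permutes_orbit_subset[OF perm] finite_subset by blast
  ultimately have "card {1..p} = (\<Sum>X\<in>insert {x0} F. card X)"
    using card_Union_disjoint[of "orbit ?\<sigma> ` {1..p}"] F by simp
  then have "p = (\<Sum>X\<in>insert {x0} F. card X)" by simp
  also have "\<dots> = 1 + card F * m"
    using finF x0F cardF by simp
  finally have "card F = (p - 1) div m" using assms(4) by simp
  moreover have "image_mset card (mset_set F) = replicate_mset (card F) m"
  proof -
    have "image_mset card (mset_set F) = image_mset (\<lambda>_. m) (mset_set F)"
      using finF cardF by (intro image_mset_cong) auto
    then show ?thesis by (simp add: image_mset_const_eq)
  qed
  ultimately show ?thesis
    unfolding cycle_type_def F using finF x0F by simp
qed

section \<open>Square roots of minus one\<close>

lemma sqrt_minus_one_imp_mod_4: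
  assumes "prime p" "2 < p" "[y ^ 2 = - 1] (mod int p)"
  shows "\<exists>k::nat. 0 < k \<and> p = 4 * k + 1"
proof -
  have not_dvd: "\<not> int p dvd 2" "\<not> int p dvd 1"
    using assms(2) by (auto dest: zdvd_imp_le)
  have odd: "odd p" using assms prime_odd_nat by blast
  have "\<not> [-1 = 0] (mod int p)" using not_dvd by (simp add: cong_iff_dvd_diff)
  moreover have "QuadRes (int p) (-1)" using assms(3) by (auto simp: QuadRes_def)
  ultimately have "Legendre (-1) (int p) = 1" by (simp add: Legendre_def)
  then have "[1 = (-1) ^ ((p - 1) div 2)] (mod int p)"
    using euler_criterion[OF assms(1,2), of "-1"] by simp
  then have "even ((p - 1) div 2)"
    using not_dvd by (cases "even ((p - 1) div 2)") (auto simp: cong_iff_dvd_diff)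
  then obtain k where "(p - 1) div 2 = 2 * k" by blast
  then have "p = 4 * k + 1" using odd by (auto elim!: oddE)
  then show ?thesis using assms(2) by auto
qed

lemma mod_4_imp_sqrt_minus_one:
  assumes "prime p" "p = 4 * k + 1" "0 < k"
  shows "\<exists>y. [y ^ 2 = - 1] (mod int p)"
proof (rule ccontr)
  assume "\<not> (\<exists>y. [y ^ 2 = - 1] (mod int p))"
  then have "\<not> QuadRes (int p) (-1)" by (simp add: QuadRes_def)
  moreover have "\<not> int p dvd 1" "\<not> int p dvd 2"
    using assms by (auto dest: zdvd_imp_le)
  ultimately have "Legendre (-1) (int p) = -1"
    by (simp add: Legendre_def cong_iff_dvd_diff)
  moreover have "(-1 :: int) ^ ((p - 1) div 2) = 1" using assms(2) by simp
  ultimately have "[- 1 = (1::int)] (mod int p)"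
    using euler_criterion[of p "-1"] assms by auto
  then show False using \<open>\<not> int p dvd 2\<close> by (simp add: cong_iff_dvd_diff)
qed

lemma square_cong_one_imp:
  assumes "prime p" "[(x::int) ^ 2 = 1] (mod int p)"
  shows "[x = 1] (mod int p) \<or> [x = - 1] (mod int p)"
proof -
  have "int p dvd (x - 1) * (x + 1)"
    using assms(2) by (simp add: cong_iff_dvd_diff power2_eq_square algebra_simps)
  then show ?thesis
    using assms(1) by (auto simp: prime_dvd_mult_iff cong_iff_dvd_diff)
qed

text \<open>
  For strict arity \<open>2 n + 1\<close>, the coset is not closed under products of \<open>n + 1\<close> factors. So
  \<open>a\<^sup>n \<noteq> \<plusminus>1\<close>, while \<open>(a\<^sup>n)\<^sup>2 = \<plusminus>1\<close>; the sign can only be negative.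
\<close>

lemma odd_strict_arity_imp_sqrt_minus_one:
  assumes "prime p" "\<not> int p dvd a" "strictly_nary (sym_group p) N (affine_coset p a)" "odd N"
  shows "\<exists>y. [y ^ 2 = - 1] (mod int p)"
proof -
  from assms(3,4) obtain n where N: "N = Suc (2 * n)" and n: "0 < n"
    by (auto simp: strictly_nary_def elim!: oddE)
  have "\<not> closed_nary (sym_group p) (Suc n) (affine_coset p a)"
    using assms(3) n by (auto simp: strictly_nary_def N)
  then have "\<not> ([a ^ n = 1] (mod int p) \<or> [a ^ n = - 1] (mod int p))"
    by (simp add: closed_nary_affine_coset_iff assms)
  then have "\<not> [(a ^ n) ^ 2 = 1] (mod int p)"
    using square_cong_one_imp[OF assms(1)] by blast
  moreover have "[(a ^ n) ^ 2 = 1] (mod int p) \<or> [(a ^ n) ^ 2 = - 1] (mod int p)"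
    using assms(3) by (simp add: strictly_nary_def N closed_nary_affine_coset_iff assms
        flip: power_mult add: mult.commute)
  ultimately show ?thesis by blast
qed

text \<open>
  An odd common order \<open>m\<close> would give \<open>1 = (-a)\<^sup>m = - a\<^sup>m = -1\<close>. So \<open>m = 2 n\<close> and \<open>a\<^sup>n = -1\<close>. If \<open>n\<close> were
  odd, then \<open>(-a)\<^sup>n = 1\<close>, contradicting the order of \<open>-a\<close>. Hence \<open>n = 2 l\<close>, and \<open>a\<^sup>l\<close> is the root.
\<close>

lemma same_order_minus_imp_sqrt_minus_one:
  assumes "prime p" "2 < p" "0 < m"
    and order: "\<And>k. [a ^ k = 1] (mod int p) \<longleftrightarrow> m dvd k"
    and order': "\<And>k. [(- a) ^ k = 1] (mod int p) \<longleftrightarrow> m dvd k"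
  shows "\<exists>y. [y ^ 2 = - 1] (mod int p)"
proof -
  have not_dvd: "\<not> int p dvd 2"
    using assms(2) by (auto dest: zdvd_imp_le)
  have even_m: "even m"
  proof (rule ccontr)
    assume "odd m"
    then have "[- (a ^ m) = 1] (mod int p)" "[a ^ m = 1] (mod int p)"
      using order[of m] order'[of m] by auto
    then have "[- (a ^ m) + a ^ m = 1 + 1] (mod int p)" by (rule cong_add)
    then show False using not_dvd by (simp add: cong_iff_dvd_diff)
  qed
  then obtain n where n: "m = 2 * n" by blast
  have half: "\<not> m dvd n" using assms(3) by (auto simp: n dest: dvd_imp_le)
  have "[(a ^ n) ^ 2 = 1] (mod int p)"
    using order[of m] by (simp add: n mult.commute flip: power_mult)
  then have minus: "[a ^ n = - 1] (mod int p)"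
    using square_cong_one_imp[OF assms(1)] order half by blast
  have "even n"
  proof (rule ccontr)
    assume "odd n"
    then have "[(- a) ^ n = 1] (mod int p)"
      using minus cong_minus_minus_iff[of "a ^ n" "-1" "int p"] by simp
    then show False using order' half by blast
  qed
  then obtain l where "n = 2 * l" by blast
  then have "[(a ^ l) ^ 2 = - 1] (mod int p)"
    using minus by (simp add: mult.commute flip: power_mult)
  then show ?thesis by blast
qed

text \<open>
  Comparing \<open>i \<mapsto> a i\<close> with \<open>i \<mapsto> -a i\<close> is enough: the lengths of their nontrivial cycles are the
  orders of \<open>a\<close> and \<open>-a\<close>. That \<open>-a \<noteq> 1\<close> is where \<open>a + 1\<close> being a unit enters.
\<close>

lemma same_cycle_type_imp_sqrt_minus_one:
  assumes "prime p" "2 < p" "\<not> int p dvd a" "\<not> int p dvd a + 1" "\<not> int p dvd a - 1"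
    and same: "\<forall>\<sigma>\<in>affine_coset p a. \<forall>\<tau>\<in>affine_coset p a. cycle_type p \<sigma> = cycle_type p \<tau>"
  shows "\<exists>y. [y ^ 2 = - 1] (mod int p)"
proof -
  have p1: "1 < p" using assms(2) by simp
  have nd: "\<not> int p dvd - a" "\<not> int p dvd - a - 1"
    using assms(3,4) dvd_minus_iff[of "int p" "a + 1"] by simp_all
  obtain m where m: "0 < m" "m dvd p - 1" "\<And>k. [a ^ k = 1] (mod int p) \<longleftrightarrow> m dvd k"
    using ex_multiplicative_order[OF assms(1,3)] by blast
  obtain n where n: "0 < n" "n dvd p - 1" "\<And>k. [(- a) ^ k = 1] (mod int p) \<longleftrightarrow> n dvd k"
    using ex_multiplicative_order[OF assms(1) nd(1)] by blast
  have "cycle_type p (affine_perm p a 0) = cycle_type p (affine_perm p (- a) 0)"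
    using same by (simp add: affine_perm_in_affine_coset_iff[OF p1])
  then have eq: "replicate_mset ((p - 1) div m) m = replicate_mset ((p - 1) div n) n"
    using cycle_type_affine_perm[OF assms(1,3,5) m(1,3)]
      cycle_type_affine_perm[OF assms(1) nd n(1,3)] by simp
  \<comment> \<open>The order can be read off only if a nontrivial cycle exists at all.\<close>
  have "0 < (p - 1) div m"
    using m p1 by (simp add: div_greater_zero_iff dvd_imp_le)
  then have "m \<in># replicate_mset ((p - 1) div n) n"
    using eq by (metis in_replicate_mset)
  then have "m = n" by (simp split: if_splits)
  then show ?thesis
    using same_order_minus_imp_sqrt_minus_one[OF assms(1,2) m(1,3)] n(3) by blast
qed

text \<open>
  A square root of \<open>-1\<close> is panmagic, because 0 and 1, the squares of the excluded residues, differ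
  from \<open>-1\<close> modulo \<open>p > 2\<close>.
\<close>

lemma sqrt_minus_one_not_dvd:
  assumes "2 < p" "[y ^ 2 = - 1] (mod int p)"
  shows "\<not> int p dvd y" "\<not> int p dvd y + 1" "\<not> int p dvd y - 1"
proof -
  have not_dvd: "\<not> int p dvd 1" "\<not> int p dvd 2"
    using assms(1) by (auto dest: zdvd_imp_le)
  have y: "int p dvd y ^ 2 + 1"
    using assms(2) by (simp add: cong_iff_dvd_diff)
  show "\<not> int p dvd y"
  proof
    assume "int p dvd y"
    then have "int p dvd y ^ 2" by (simp add: power2_eq_square)
    then show False using y not_dvd by (metis dvd_add_right_iff)
  qed
  have "y ^ 2 + 1 = (y + 1) * (y - 1) + 2"
    by (simp add: power2_eq_square algebra_simps)
  then have "\<not> int p dvd (y + 1) * (y - 1)"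
    using y not_dvd by (metis dvd_add_right_iff)
  then show "\<not> int p dvd y + 1" "\<not> int p dvd y - 1" by auto
qed

lemma sqrt_minus_one_imp_order_4:
  assumes "prime p" "2 < p" "[y ^ 2 = - 1] (mod int p)"
  shows "[y ^ k = 1] (mod int p) \<longleftrightarrow> 4 dvd k"
proof -
  obtain m where m: "0 < m" "\<And>k. [y ^ k = 1] (mod int p) \<longleftrightarrow> m dvd k"
    using ex_multiplicative_order[OF assms(1) sqrt_minus_one_not_dvd(1)[OF assms(2,3)]] by blast
  have "[(y ^ 2) ^ 2 = (- 1) ^ 2] (mod int p)"
    using assms(3) by (rule cong_pow)
  then have "m dvd 4" by (simp flip: m(2) power_mult)
  moreover have "\<not> m dvd 2"
  proof
    assume "m dvd 2"
    then have "[- 1 = (1::int)] (mod int p)"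
      using m(2)[of 2] assms(3) cong_sym cong_trans by blast
    then have "int p dvd 2" by (simp add: cong_iff_dvd_diff)
    then show False using assms(2) by (auto dest: zdvd_imp_le)
  qed
  moreover have "m \<in> {1, 2, 3, 4}"
    using \<open>m dvd 4\<close> m(1) dvd_imp_le[of m 4] by auto
  ultimately have "m = 4" by auto
  then show ?thesis using m(2) by simp
qed

text \<open>
  Since \<open>a\<close> and \<open>-a\<close> have the same square, both linear parts occurring in the coset are square
  roots of \<open>-1\<close> and hence of order 4.
\<close>

lemma sqrt_minus_one_imp_same_cycle_type:
  assumes "prime p" "2 < p" "[a ^ 2 = - 1] (mod int p)" and "\<sigma> \<in> affine_coset p a"
  shows "cycle_type p \<sigma> = add_mset 1 (replicate_mset ((p - 1) div 4) 4)"
proof -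
  obtain e c where e: "e \<in> {1, -1}" and \<sigma>: "\<sigma> = affine_perm p (e * a) c"
    using assms(4) by (auto simp: affine_coset_def)
  have "[(e * a) ^ 2 = - 1] (mod int p)"
    using e assms(3) by auto
  then show ?thesis
    unfolding \<sigma>
    using assms(1,2) sqrt_minus_one_not_dvd sqrt_minus_one_imp_order_4
    by (intro cycle_type_affine_perm) auto
qed

lemma sqrt_minus_one_imp_strictly_ternary:
  assumes "prime p" "2 < p" "[a ^ 2 = - 1] (mod int p)"
  shows "strictly_nary (sym_group p) 3 (affine_coset p a)"
proof -
  note nd = sqrt_minus_one_not_dvd[OF assms(2,3)]
  have closed_iff: "closed_nary (sym_group p) (Suc m) (affine_coset p a) \<longleftrightarrow>
    [a ^ m = 1] (mod int p) \<or> [a ^ m = - 1] (mod int p)" for m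
    by (rule closed_nary_affine_coset_iff[OF assms(1) nd(1)])
  have "closed_nary (sym_group p) 3 (affine_coset p a)"
    using closed_iff[of 2] assms(3) by (simp add: numeral_3_eq_3 numeral_2_eq_2)
  moreover have "\<not> closed_nary (sym_group p) 2 (affine_coset p a)"
    using closed_iff[of 1] nd by (simp add: numeral_2_eq_2 cong_iff_dvd_diff)
  moreover have "N = 2" if "2 \<le> N" "N < 3" for N :: nat using that by simp
  ultimately show ?thesis unfolding strictly_nary_def by fastforce
qed

theorem corollary5:
  fixes p :: nat
  assumes "prime p"
  shows
    "((\<exists>C\<in>panmagic_cosets p. \<forall>\<sigma>\<in>C. \<forall>\<tau>\<in>C. cycle_type p \<sigma> = cycle_type p \<tau>)
        \<longleftrightarrow> (\<exists>C\<in>panmagic_cosets p. \<exists>N. strictly_nary (sym_group p) N C \<and> odd N))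
     \<and> ((\<exists>C\<in>panmagic_cosets p. \<exists>N. strictly_nary (sym_group p) N C \<and> odd N)
        \<longleftrightarrow> (\<exists>C\<in>panmagic_cosets p. strictly_nary (sym_group p) 3 C))
     \<and> ((\<exists>C\<in>panmagic_cosets p. strictly_nary (sym_group p) 3 C)
        \<longleftrightarrow> (\<exists>k::nat. 0 < k \<and> p = 4 * k + 1))"
    (is "(?i \<longleftrightarrow> ?ii) \<and> (?ii \<longleftrightarrow> ?iii) \<and> (?iii \<longleftrightarrow> ?iv)")
proof -
  \<comment> \<open>The bound cannot be dropped: modulo 2, \<open>-1 = 1\<close> is a square, and yet there is no panmagic coset.\<close>
  let ?root = "2 < p \<and> (\<exists>y. [y ^ 2 = - 1] (mod int p))"
  have two: "2 < p" if C: "C \<in> panmagic_cosets p" for C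
  proof -
    obtain a where "\<not> int p dvd a" "\<not> int p dvd a + 1"
      using C unfolding panmagic_cosets_iff[OF assms] by blast
    then have "p \<noteq> 2" by (metis even_add odd_one of_nat_numeral)
    then show ?thesis using prime_ge_2_nat[OF assms] by simp
  qed
  have "?root" if i: ?i
  proof -
    obtain C where C: "C \<in> panmagic_cosets p"
      and same: "\<forall>\<sigma>\<in>C. \<forall>\<tau>\<in>C. cycle_type p \<sigma> = cycle_type p \<tau>"
      using i by blast
    obtain a where a: "\<not> int p dvd a" "\<not> int p dvd a + 1" "\<not> int p dvd a - 1"
      and Ca: "C = affine_coset p a"
      using C unfolding panmagic_cosets_iff[OF assms] by blast
    show ?thesis
      using two[OF C] same_cycle_type_imp_sqrt_minus_one[OF assms two[OF C] a same[unfolded Ca]]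
      by blast
  qed
  moreover have "?root" if ii: ?ii
  proof -
    obtain C N where C: "C \<in> panmagic_cosets p"
      and N: "strictly_nary (sym_group p) N C" "odd N"
      using ii by blast
    obtain a where a: "\<not> int p dvd a" and Ca: "C = affine_coset p a"
      using C unfolding panmagic_cosets_iff[OF assms] by blast
    show ?thesis
      using two[OF C] odd_strict_arity_imp_sqrt_minus_one[OF assms a N[unfolded Ca]] by blast
  qed
  moreover have "?iii \<Longrightarrow> ?ii"
    by (metis odd_numeral)
  moreover have "?root \<longleftrightarrow> ?iv"
    using sqrt_minus_one_imp_mod_4[OF assms] mod_4_imp_sqrt_minus_one[OF assms] by fastforce
  moreover have "?i \<and> ?iii" if root: ?root
  proof -
    obtain y where p2: "2 < p" and y: "[y ^ 2 = - 1] (mod int p)" using root by blast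
    have "affine_coset p y \<in> panmagic_cosets p"
      using sqrt_minus_one_not_dvd[OF p2 y] by (auto simp: panmagic_cosets_iff[OF assms])
    then show ?thesis
      using sqrt_minus_one_imp_same_cycle_type[OF assms p2 y]
        sqrt_minus_one_imp_strictly_ternary[OF assms p2 y] by metis
  qed
  ultimately show ?thesis by argo
qed

end
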